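(* Let $p$ be a pattern. Then $p$ is avoidable in the ordinary sense if and only if $p$ is avoidable up to $\simeq$.
   Context: For a word $x=x_1\cdots x_n$ (letters $x_i$), its reversal is $x^R=x_n\cdots x_1$. Let $\simeq$ be the equivalence relation on words with $x\simeq x'$ iff $x'=x$ or $x'=x^R$. A pattern is a word $p=p_1p_2\cdots p_n$ over an alphabet $V$ of variables. For an equivalence relation $\sim$ on words, a word $w$ encounters $p$ up to $\sim$ if $w$ has a factor $X_1X_2\cdots X_n$ where each $X_i$ is a nonempty word and $X_i\sim X_j$ whenever $p_i=p_j$; otherwise $w$ avoids $p$ up to $\sim$. The pattern $p$ is $k$-avoidable up to $\sim$ if some infinite word over a $k$-letter alphabet avoids $p$ up to $\sim$, and avoidable up to $\sim$ if it is $k$-avoidable up to $\sim$ for some $k$. Avoidable in the ordinary sense means avoidable up to equality $=$. *)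

theory Defs
  imports "HOL-Library.Omega_Words_Fun"
begin

definition rev_equiv :: "'a list \<Rightarrow> 'a list \<Rightarrow> bool"  (infix \<open>\<simeq>\<close> 50)
  where "x \<simeq> x' \<longleftrightarrow> x' = x \<or> x' = rev x"

lemma equivp_rev_equiv: "equivp (\<simeq>)"
  by (rule equivpI) (auto simp: rev_equiv_def reflp_def symp_def transp_def)

definition factor_of :: "'a list \<Rightarrow> 'a word \<Rightarrow> bool"
  where "factor_of u w \<longleftrightarrow> (\<exists>i j. i \<le> j \<and> u = w [i \<rightarrow> j])"

definition encounters :: "('a list \<Rightarrow> 'a list \<Rightarrow> bool) \<Rightarrow> 'a word \<Rightarrow> 'v list \<Rightarrow> bool"
  where "encounters R w p \<longleftrightarrow>
    (\<exists>Xs. length Xs = length p \<and> factor_of (concat Xs) w \<and>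
      (\<forall>i < length p. Xs ! i \<noteq> []) \<and>
      (\<forall>i < length p. \<forall>j < length p. p ! i = p ! j \<longrightarrow> R (Xs ! i) (Xs ! j)))"

abbreviation avoids :: "('a list \<Rightarrow> 'a list \<Rightarrow> bool) \<Rightarrow> 'a word \<Rightarrow> 'v list \<Rightarrow> bool"
  where "avoids R w p \<equiv> \<not> encounters R w p"

text \<open>Letters are drawn from \<^typ>\<open>nat\<close>, which contains a \<open>k\<close>-letter alphabet for every \<open>k\<close>.\<close>

definition k_avoidable :: "nat \<Rightarrow> (nat list \<Rightarrow> nat list \<Rightarrow> bool) \<Rightarrow> 'v list \<Rightarrow> bool"
  where "k_avoidable k R p \<longleftrightarrow>
    (\<exists>A w. finite A \<and> card A = k \<and> range w \<subseteq> A \<and> avoids R w p)"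

definition avoidable :: "(nat list \<Rightarrow> nat list \<Rightarrow> bool) \<Rightarrow> 'v list \<Rightarrow> bool"
  where "avoidable R p \<longleftrightarrow> (\<exists>k. k_avoidable k R p)"

end

theory Submission
  imports Defs
begin

text \<open>
  Equality refines \<open>\<simeq>\<close>, so a word avoiding \<open>p\<close> up to \<open>\<simeq>\<close> avoids \<open>p\<close>. Conversely, given a word \<open>w\<close>
  avoiding \<open>p\<close>, tag each letter with its position modulo 3. Along a factor of the tagged word the
  tag always increases by 1 modulo 3. As this relation between consecutive letters is asymmetric,
  the reversal of a factor of length at least 2 is never a factor.
  On factors of the tagged word \<open>\<simeq>\<close> therefore coincides with equality, and erasing the tags turns
  an occurrence of \<open>p\<close> up to \<open>\<simeq>\<close> into an ordinary one in \<open>w\<close>.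
\<close>

lemma factor_of_appendD:
  assumes "factor_of (u @ v) w"
  shows "factor_of u w" and "factor_of v w"
proof -
  from assms obtain i j where "i \<le> j" and uv: "u @ v = w [i \<rightarrow> j]"
    by (auto simp: factor_of_def)
  have length: "length u + length v = j - i"
    using arg_cong[OF uv, of length] by simp
  have "u = w [i \<rightarrow> i + length u]"
    using arg_cong[OF uv, of "take (length u)"] length \<open>i \<le> j\<close> by simp
  then show "factor_of u w"
    unfolding factor_of_def by (metis le_add1)
  have "v = w [i + length u \<rightarrow> j]"
    using arg_cong[OF uv, of "drop (length u)"] by simp
  moreover have "i + length u \<le> j"
    using length \<open>i \<le> j\<close> by simp
  ultimately show "factor_of v w"
    unfolding factor_of_def by blast
qed

lemma factor_of_concatD:
  assumes "factor_of (concat us) w" and "u \<in> set us"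
  shows "factor_of u w"
proof -
  from assms(2) obtain us' us'' where "us = us' @ u # us''"
    by (meson split_list)
  with assms(1) have "factor_of (concat us' @ u @ concat us'') w"
    by simp
  then show ?thesis
    by (rule factor_of_appendD(1)[OF factor_of_appendD(2)])
qed

lemma factor_of_map:
  assumes "factor_of u w"
  shows "factor_of (map f u) (f \<circ> w)"
  using assms unfolding factor_of_def subsequence_def by (metis map_map)

lemma successively_factor_of:
  assumes "\<And>n. P (w n) (w (Suc n))" and "factor_of u w"
  shows "successively P u"
  using assms by (auto simp: factor_of_def successively_conv_nth)

lemma encounters_map:
  assumes "encounters R w p"
    and "\<And>x y. factor_of x w \<Longrightarrow> factor_of y w \<Longrightarrow> R x y \<Longrightarrow> S (map f x) (map f y)"
  shows "encounters S (f \<circ> w) p"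
proof -
  from assms(1) obtain Xs where length: "length Xs = length p"
    and factor: "factor_of (concat Xs) w"
    and nonempty: "\<And>i. i < length p \<Longrightarrow> Xs ! i \<noteq> []"
    and related: "\<And>i j. i < length p \<Longrightarrow> j < length p \<Longrightarrow> p ! i = p ! j \<Longrightarrow> R (Xs ! i) (Xs ! j)"
    unfolding encounters_def by blast
  have "factor_of (Xs ! i) w" if "i < length p" for i
    using that length by (simp add: factor_of_concatD[OF factor])
  then have "S (map f (Xs ! i)) (map f (Xs ! j))"
    if "i < length p" "j < length p" "p ! i = p ! j" for i j
    using that related assms(2) by blast
  moreover have "factor_of (concat (map (map f) Xs)) (f \<circ> w)"
    using factor_of_map[OF factor] by (simp add: map_concat)
  ultimately show ?thesis
    unfolding encounters_def using length nonempty
    by (intro exI[of _ "map (map f) Xs"]) simp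
qed

lemma encounters_rev_equiv_if_eq: "encounters (=) w p \<Longrightarrow> encounters (\<simeq>) w p"
  using encounters_map[of "(=)" w p "(\<simeq>)" id] by (simp add: rev_equiv_def)

lemma rev_eq_self_if_successively_asymp:
  assumes "asymp P" and "successively P x" and "successively P (rev x)"
  shows "rev x = x"
proof (cases x rule: remdups_adj.cases)
  case (3 a b ys)
  then have "P a b" and "P b a"
    using assms(2,3) unfolding successively_rev by simp_all
  with \<open>asymp P\<close> show ?thesis
    by (auto dest: asympD)
qed simp_all

lemma encounters_eq_if_rev_equiv_asymp:
  assumes "asymp P" and succ: "\<And>n. P (w n) (w (Suc n))" and "encounters (\<simeq>) w p"
  shows "encounters (=) w p"
proof -
  have "x = y" if "factor_of x w" "factor_of y w" "x \<simeq> y" for x y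
    using \<open>x \<simeq> y\<close> unfolding rev_equiv_def
  proof
    assume "y = rev x"
    moreover have "successively P x" "successively P y"
      using that successively_factor_of[of P w, OF succ] by blast+
    ultimately show "x = y"
      using rev_eq_self_if_successively_asymp[OF \<open>asymp P\<close>] by metis
  qed simp
  then show ?thesis
    using encounters_map[OF \<open>encounters (\<simeq>) w p\<close>, of "(=)" id] by simp
qed

definition mod3_tag :: "nat word \<Rightarrow> nat word"
  where "mod3_tag w n = 3 * w n + n mod 3"

definition mod3_succ :: "nat \<Rightarrow> nat \<Rightarrow> bool"
  where "mod3_succ a b \<longleftrightarrow> b mod 3 = Suc a mod 3"

lemma div3_comp_mod3_tag: "(\<lambda>a. a div 3) \<circ> mod3_tag w = w"
  by (auto simp: mod3_tag_def)

lemma mod3_succ_mod3_tag: "mod3_succ (mod3_tag w n) (mod3_tag w (Suc n))"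
  by (simp add: mod3_succ_def mod3_tag_def mod_Suc)

lemma asymp_mod3_succ: "asymp mod3_succ"
  unfolding mod3_succ_def by (rule asympI) presburger

lemma finite_range_mod3_tag:
  assumes "finite (range w)"
  shows "finite (range (mod3_tag w))"
proof (rule finite_subset)
  show "range (mod3_tag w) \<subseteq> (\<lambda>(a, b). 3 * a + b) ` (range w \<times> {..<3})"
    by (force simp: mod3_tag_def)
qed (use assms in simp)

lemma avoids_rev_equiv_mod3_tag:
  assumes "avoids (=) w p"
  shows "avoids (\<simeq>) (mod3_tag w) p"
proof
  assume "encounters (\<simeq>) (mod3_tag w) p"
  then have "encounters (=) (mod3_tag w) p"
    using encounters_eq_if_rev_equiv_asymp[OF asymp_mod3_succ, of "mod3_tag w"]
      mod3_succ_mod3_tag by blast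
  then have "encounters (=) ((\<lambda>a. a div 3) \<circ> mod3_tag w) p"
    by (rule encounters_map) simp
  with assms show False
    by (simp add: div3_comp_mod3_tag)
qed

lemma avoidable_iff_finite_range:
  "avoidable R p \<longleftrightarrow> (\<exists>w. finite (range w) \<and> avoids R w p)"
  unfolding avoidable_def k_avoidable_def by (auto intro: finite_subset)

theorem theorem2:
  fixes p :: "'v list"
  shows "avoidable (=) p \<longleftrightarrow> avoidable (\<simeq>) p"
proof
  assume "avoidable (=) p"
  then obtain w :: "nat word" where "finite (range w)" and "avoids (=) w p"
    unfolding avoidable_iff_finite_range by blast
  then have "finite (range (mod3_tag w))" and "avoids (\<simeq>) (mod3_tag w) p"
    using finite_range_mod3_tag avoids_rev_equiv_mod3_tag by blast+
  then show "avoidable (\<simeq>) p"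
    unfolding avoidable_iff_finite_range by blast
next
  assume "avoidable (\<simeq>) p"
  then show "avoidable (=) p"
    unfolding avoidable_iff_finite_range
    using encounters_rev_equiv_if_eq by blast
qed

end
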